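(* For any megamatroid $\mathrm{rk}:2^{[d]}\to\mathbb Z\cup\{\infty\}$ we have the identity of functions $\mathbb R^d\to\mathbb Z$ $$[Q(\mathrm{rk})]=\sum_{\underline X}(-1)^{d-\ell(\underline X)}[R_{\mathrm{MM}}(\underline X,\mathrm{rk})],$$ where the sum is over all chains $\underline X$ in $[d]$.
   Context: $[d]=\{1,\dots,d\}$. A megamatroid on $[d]$ is a function $\mathrm{rk}:2^{[d]}\to\mathbb Z\cup\{\infty\}$ with $\mathrm{rk}(\emptyset)=0$, $\mathrm{rk}([d])\in\mathbb Z$, and such that whenever $\mathrm{rk}(A),\mathrm{rk}(B)\in\mathbb Z$ we have $\mathrm{rk}(A\cup B),\mathrm{rk}(A\cap B)\in\mathbb Z$ and $\mathrm{rk}(A\cup B)+\mathrm{rk}(A\cap B)\le\mathrm{rk}(A)+\mathrm{rk}(B)$. Base polyhedron $Q(\mathrm{rk})=\{y\in\mathbb R^d:\sum_iy_i=\mathrm{rk}([d]),\ \sum_{i\in A}y_i\le\mathrm{rk}(A)\ \forall A\}$ (inequalities with $\infty$ vacuous); $[\Pi]$ is the indicator function of $\Pi$. A chain of length $k$ in $[d]$ is $\underline X:\emptyset\subset X_1\subset\dots\subset X_k=[d]$ with strict inclusions; $\ell(\underline X)=k$ (for $d=0$ there is exactly one chain, of length $0$). For such a chain, $R_{\mathrm{MM}}(\underline X,\mathrm{rk})=\{y\in\mathbb R^d:\sum_{i=1}^dy_i=\mathrm{rk}([d]),\ \sum_{i\in X_j}y_i\le\mathrm{rk}(X_j)\text{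 for }j=1,\dots,k\}$ (inequalities with $\infty$ vacuous). *)

theory Defs
  imports Complex_Main "HOL-Library.FuncSet" "HOL-Library.Extended_Real"
    "HOL-Library.Indicator_Function"
begin

(* Rank functions take values in ereal; finite values are required to be integers and
   minus infinity is excluded. Only the values at subsets of {1..d} are meaningful. *)
definition int_ereals :: "ereal set" where
  "int_ereals = range (\<lambda>k::int. ereal (of_int k))"

definition megamatroid :: "nat \<Rightarrow> (nat set \<Rightarrow> ereal) \<Rightarrow> bool" where
  "megamatroid d rk \<longleftrightarrow>
     (\<forall>A. A \<subseteq> {1..d} \<longrightarrow> rk A \<in> int_ereals \<union> {\<infinity>}) \<and>
     rk {} = 0 \<and>
     rk {1..d} \<in> int_ereals \<and>
     (\<forall>A B. A \<subseteq> {1..d} \<longrightarrow> B \<subseteq> {1..d} \<longrightarrow> rk A \<in> int_ereals \<longrightarrow> rk B \<in> int_ereals \<longrightarrow>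
        rk (A \<union> B) \<in> int_ereals \<and> rk (A \<inter> B) \<in> int_ereals \<and>
        rk (A \<union> B) + rk (A \<inter> B) \<le> rk A + rk B)"

(* Real d-space with coordinates indexed by {1..d}; extensional functions make this
   a faithful copy for every d, including the one-point space for d = 0. *)
definition real_space :: "nat \<Rightarrow> (nat \<Rightarrow> real) set" where
  "real_space d = {1..d} \<rightarrow>\<^sub>E UNIV"

definition base_polyhedron :: "nat \<Rightarrow> (nat set \<Rightarrow> ereal) \<Rightarrow> (nat \<Rightarrow> real) set" where
  "base_polyhedron d rk =
     {y \<in> real_space d. ereal (\<Sum>i=1..d. y i) = rk {1..d} \<and>
        (\<forall>A. A \<subseteq> {1..d} \<longrightarrow> ereal (\<Sum>i\<in>A. y i) \<le> rk A)}"

(* The list [X_1, ..., X_k] encodes the chain; the empty set is prepended and is not counted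
   in the length. For d = 0 the only chain is the empty list. *)
definition is_chain :: "nat \<Rightarrow> nat set list \<Rightarrow> bool" where
  "is_chain d Xs \<longleftrightarrow> sorted_wrt (\<subset>) ({} # Xs) \<and> last ({} # Xs) = {1..d}"

definition R_MM :: "nat \<Rightarrow> nat set list \<Rightarrow> (nat set \<Rightarrow> ereal) \<Rightarrow> (nat \<Rightarrow> real) set" where
  "R_MM d Xs rk =
     {y \<in> real_space d. ereal (\<Sum>i=1..d. y i) = rk {1..d} \<and>
        (\<forall>X\<in>set Xs. ereal (\<Sum>i\<in>X. y i) \<le> rk X)}"

lemma is_chain_0: "is_chain 0 Xs \<longleftrightarrow> Xs = []"
proof
  assume c: "is_chain 0 Xs"
  show "Xs = []"
  proof (rule ccontr)
    assume "Xs \<noteq> []"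
    then have "last Xs \<in> set Xs" by simp
    then have "{} \<subset> last Xs"
      using c unfolding is_chain_def by (metis sorted_wrt.simps(2))
    moreover have "last Xs = {}"
      using c \<open>Xs \<noteq> []\<close> by (simp add: is_chain_def)
    ultimately show False by simp
  qed
qed (simp add: is_chain_def)

lemma is_chain_subset:
  assumes "is_chain d Xs" "X \<in> set Xs"
  shows "X \<subseteq> {1..d}"
proof (cases Xs rule: rev_cases)
  case Nil
  then show ?thesis using assms by simp
next
  case (snoc Ys Y)
  then show ?thesis using assms
    by (auto simp: is_chain_def sorted_wrt_append split: if_splits)
qed

lemma sorted_psubset_length:
  assumes "sorted_wrt (\<subset>) (A # Xs)" "finite (last (A # Xs))"
  shows "length Xs + card A \<le> card (last (A # Xs))"
  using assms
proof (induction Xs arbitrary: A)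
  case Nil
  then show ?case by simp
next
  case (Cons B Xs)
  have IH: "length Xs + card B \<le> card (last (B # Xs))"
    using Cons by simp
  have "B \<subseteq> last (B # Xs)"
    using Cons.prems(1) by (cases Xs rule: rev_cases) (auto simp: sorted_wrt_append)
  then have "finite B"
    using Cons.prems(2) by (metis finite_subset last_ConsR list.distinct(1))
  moreover have "A \<subset> B" using Cons.prems(1) by simp
  ultimately have "card A < card B" by (rule psubset_card_mono)
  with IH show ?case by simp
qed

(* Hence the truncated subtraction d - length Xs is the true difference. *)
lemma is_chain_length: "is_chain d Xs \<Longrightarrow> length Xs \<le> d"
  using sorted_psubset_length[of "{}" Xs] by (simp add: is_chain_def)

(* Hence the sum over all chains is a genuine finite sum. *)
lemma finite_is_chain: "finite {Xs. is_chain d Xs}"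
proof (rule finite_subset)
  show "{Xs. is_chain d Xs} \<subseteq> {Xs. set Xs \<subseteq> Pow {1..d} \<and> length Xs \<le> d}"
    using is_chain_subset is_chain_length by blast
  show "finite {Xs. set Xs \<subseteq> Pow {1..d} \<and> length Xs \<le> d}"
    by (rule finite_lists_length_le) simp
qed

end

theory Submission imports Defs begin

text \<open>
  Fix \<open>y\<close> with the right coordinate sum and call \<open>A\<close> bad if \<open>rk A < y A\<close>. The right-hand side is
  the signed count of full chains avoiding the bad sets. By inclusion-exclusion it becomes a sum over
  chains \<open>C\<close> of bad sets, in which the full chains refining \<open>C\<close> always contribute the same total sign;
  what is left is \<open>1 - \<chi>\<close> for the Euler characteristic \<open>\<chi>\<close> of the order complex of the bad sets. If
  there are bad sets and \<open>T\<close> minimises \<open>rk - y\<close>, then submodularity makes \<open>A \<union> T\<close> bad for every bad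
  \<open>A\<close>, so \<open>A \<subseteq> A \<union> T \<supseteq> T\<close> contracts the complex and \<open>\<chi> = 1\<close>.
\<close>

section \<open>Toggling an element of a chain\<close>

definition toggle :: "'a \<Rightarrow> 'a set \<Rightarrow> 'a set" where
  "toggle a X = (if a \<in> X then X - {a} else insert a X)"

text \<open>\<open>X \<mapsto> toggle (h X) X\<close> is an involution on \<open>S\<close>, because
  \<open>h\<close> takes the same value before and after, and it changes the cardinality by one. So
  the sum equals its own negative.\<close>

lemma sum_toggle_eq_0:
  fixes S :: "'a set set"
  assumes "\<And>X. X \<in> S \<Longrightarrow> finite X"
    and "\<And>X. X \<in> S \<Longrightarrow> toggle (h X) X \<in> S"
    and "\<And>X. X \<in> S \<Longrightarrow> h (toggle (h X) X) = h X"
  shows "(\<Sum>X\<in>S. (-1) ^ card X) = (0::int)"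
proof -
  have tt: "toggle a (toggle a X) = X" for a and X :: "'a set"
    by (auto simp: toggle_def)
  have sgn: "(-1) ^ card (toggle a X) = - ((-1) ^ card X :: int)" if "finite X" for a and X :: "'a set"
  proof (cases "a \<in> X")
    case True
    then obtain Y where "X = insert a Y" "a \<notin> Y"
      by (meson mk_disjoint_insert)
    then show ?thesis using that by (simp add: toggle_def)
  qed (use that in \<open>simp add: toggle_def\<close>)
  have "(\<Sum>X\<in>S. (-1) ^ card X) = (\<Sum>X\<in>S. - ((-1) ^ card X :: int))"
    by (rule sum.reindex_bij_witness[where i = "\<lambda>X. toggle (h X) X" and j = "\<lambda>X. toggle (h X) X"])
      (simp_all add: assms tt sgn)
  then show ?thesis by (simp add: sum_negf)
qed

text \<open>For a finite chain \<open>X\<close> this is \<open>W \<union> T\<close> with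
  \<open>W\<close> the largest member not containing \<open>T\<close>, or \<open>T\<close> itself if
  every member contains \<open>T\<close>.\<close>

definition pivot :: "'a set \<Rightarrow> 'a set set \<Rightarrow> 'a set" where
  "pivot T X = T \<union> \<Union>{W \<in> X. \<not> T \<subseteq> W}"

text \<open>The pivot contains \<open>T\<close>, so toggling it leaves alone the members that define
  it.\<close>

lemma pivot_toggle: "pivot T (toggle (pivot T X) X) = pivot T X"
proof -
  have "{W \<in> toggle (pivot T X) X. \<not> T \<subseteq> W} = {W \<in> X. \<not> T \<subseteq> W}"
    by (auto simp: toggle_def pivot_def)
  then show ?thesis by (simp add: pivot_def)
qed

text \<open>A member that does not contain \<open>T\<close> lies below the pivot by definition. One
  that contains \<open>T\<close> also lies above every member that does not, hence above the
  pivot.\<close>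

lemma chain_toggle_pivot:
  assumes "subset.chain \<A> X" "pivot T X \<in> \<A>"
  shows "subset.chain \<A> (toggle (pivot T X) X)"
proof -
  have "pivot T X \<subseteq> Z \<or> Z \<subseteq> pivot T X" if "Z \<in> X" for Z
    using assms(1) that unfolding pivot_def subset_chain_def by blast
  then show ?thesis
    using assms unfolding toggle_def subset_chain_def by auto
qed

lemma pivot_cases:
  assumes "subset.chain \<A> X" "finite X"
  obtains "pivot T X = T" | W where "W \<in> X" "\<not> T \<subseteq> W" "pivot T X = W \<union> T"
proof (cases "{W \<in> X. \<not> T \<subseteq> W} = {}")
  case True
  then have "pivot T X = T" unfolding pivot_def by blast
  then show ?thesis using that by blast
next
  case False
  have "subset.chain \<A> {W \<in> X. \<not> T \<subseteq> W}"
    using assms(1) by (auto simp: subset_chain_def)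
  then have "\<Union>{W \<in> X. \<not> T \<subseteq> W} \<in> {W \<in> X. \<not> T \<subseteq> W}"
    using False assms(2) by (intro Union_in_chain) auto
  then show ?thesis
    using that(2)[of "\<Union>{W \<in> X. \<not> T \<subseteq> W}"] by (simp add: pivot_def Un_commute)
qed

text \<open>With the empty chain counted, the sum is 1 - \<chi> for the order complex of
  \<open>B\<close>. Toggling the pivot is the combinatorial form of the contraction: the pivot is
  \<open>T\<close> or \<open>W \<union> T\<close> with \<open>W\<close> in \<open>C\<close>, so it
  stays in \<open>B\<close>.\<close>

lemma sum_chains_conically_contractible:
  assumes "finite B" "T \<in> B" "\<And>A. A \<in> B \<Longrightarrow> A \<union> T \<in> B"
  shows "(\<Sum>C | subset.chain B C. (-1) ^ card C) = (0::int)"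
proof (rule sum_toggle_eq_0[where h = "pivot T"])
  fix C assume "C \<in> {C. subset.chain B C}"
  then have C: "subset.chain B C" by simp
  then show fin: "finite C"
    using assms(1) by (auto simp: subset_chain_def intro: finite_subset)
  have "pivot T C \<in> B"
    using C fin
  proof (cases rule: pivot_cases[of B C T])
    case (2 W)
    then show ?thesis using C assms(3)[of W] by (auto simp: subset_chain_def)
  qed (simp add: assms(2))
  with C show "toggle (pivot T C) C \<in> {C. subset.chain B C}"
    by (simp add: chain_toggle_pivot)
qed (rule pivot_toggle)

section \<open>Full chains of subsets\<close>

text \<open>Unlike in the list encoding, \<open>{}\<close> is a member, so the cardinality exceeds
  the length of the chain by one.\<close>

definition full_chains :: "'a set \<Rightarrow> 'a set set set" where
  "full_chains U = {X. subset.chain (Pow U) X \<and> {} \<in> X \<and> U \<in> X}"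

lemma finite_full_chain: "finite U \<Longrightarrow> X \<in> full_chains U \<Longrightarrow> finite X"
  by (auto simp: full_chains_def subset_chain_def intro: finite_subset)

lemma finite_full_chains:
  assumes "finite U"
  shows "finite (full_chains U)"
proof (rule finite_subset)
  show "full_chains U \<subseteq> Pow (Pow U)"
    by (auto simp: full_chains_def subset_chain_def)
qed (use assms in simp)

text \<open>Toggling with \<open>T = {e}\<close>, for \<open>e\<close> in \<open>U\<close> but in no smaller member of \<open>C\<close>, cancels all
  refinements of \<open>C\<close> except those containing \<open>U - {e}\<close>.\<close>

lemma sum_full_chains_refining:
  assumes "finite U" "subset.chain (Pow U) C"
  shows "(\<Sum>X | X \<in> full_chains U \<and> C \<subseteq> X. (-1) ^ card X) = ((-1) ^ Suc (card U) :: int)"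
  using assms
proof (induction "card U" arbitrary: U C)
  case 0
  then have "U = {}" by simp
  then have "{X. X \<in> full_chains U \<and> C \<subseteq> X} = {{{}}}"
    using 0 by (auto simp: full_chains_def subset_chain_def)
  with \<open>U = {}\<close> show ?case by simp
next
  case (Suc n)
  let ?S = "{X. X \<in> full_chains U \<and> C \<subseteq> X}"
  have finC: "finite C"
    using Suc.prems by (auto simp: subset_chain_def intro: finite_subset)
  have chD: "subset.chain (Pow U) (C - {U})"
    using Suc.prems by (auto simp: subset_chain_def)
  \<comment> \<open>\<open>C - {U}\<close> is empty, and then \<open>card U = Suc n\<close> helps,
    or it has a greatest member, which is not \<open>U\<close>. Any point of \<open>U\<close>
    outside the union serves as \<open>e\<close>.\<close>
  have "\<Union>(C - {U}) \<noteq> U"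
  proof (cases "C - {U} = {}")
    case True
    then show ?thesis using Suc.hyps(2) by (metis Union_empty card.empty nat.distinct(1))
  next
    case False
    then have "\<Union>(C - {U}) \<in> C - {U}"
      using chD finC by (intro Union_in_chain) auto
    then show ?thesis by blast
  qed
  moreover have "\<Union>(C - {U}) \<subseteq> U"
    using chD by (auto simp: subset_chain_def)
  ultimately obtain e where e: "e \<in> U" "\<And>Z. Z \<in> C \<Longrightarrow> e \<in> Z \<Longrightarrow> Z = U"
    by blast
  let ?U = "U - {e}"
  have cU: "card ?U = n" "finite ?U"
    using Suc e by auto
  have "(\<Sum>X\<in>{X\<in>?S. ?U \<notin> X}. (-1) ^ card X) = (0::int)"
  proof (rule sum_toggle_eq_0[where h = "pivot {e}"])
    fix X assume "X \<in> {X\<in>?S. ?U \<notin> X}"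
    then have X: "X \<in> full_chains U" "C \<subseteq> X" "?U \<notin> X" by auto
    then have ch: "subset.chain (Pow U) X" "{} \<in> X" "U \<in> X"
      by (auto simp: full_chains_def)
    show fin: "finite X" using X Suc.prems finite_full_chain by blast
    have XU: "X \<subseteq> Pow U" using ch by (auto simp: subset_chain_def)
    have p: "pivot {e} X \<subseteq> U" using e XU by (auto simp: pivot_def)
    have eq: "e \<in> pivot {e} X" by (simp add: pivot_def)
    \<comment> \<open>\<open>U\<close> must not be toggled away. The pivot could equal
      \<open>U\<close> only if \<open>U - {e}\<close> were \<open>{}\<close> or a member of
      \<open>X\<close>; since \<open>{}\<close> is in \<open>X\<close>, the assumption
      \<open>U - {e} \<notin> X\<close> excludes both.\<close>
    have ne: "pivot {e} X \<noteq> U"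
    proof
      assume a: "pivot {e} X = U"
      from ch(1) fin show False
      proof (cases rule: pivot_cases[of "Pow U" X "{e}"])
        case 1
        then have "?U = {}" using a by auto
        then show False using X(3) ch(2) by metis
      next
        case (2 W)
        then have "W = ?U" using a by auto
        then show False using X(3) 2(1) by metis
      qed
    qed
    \<comment> \<open>\<open>U\<close> is the only member of \<open>C\<close> that can contain
      \<open>e\<close>, so the toggle preserves \<open>C \<subseteq> X\<close>.\<close>
    have "pivot {e} X \<notin> C" using e eq ne by blast
    moreover have "pivot {e} X \<noteq> {}" "pivot {e} X \<noteq> ?U" using eq by auto
    moreover have "subset.chain (Pow U) (toggle (pivot {e} X) X)"
      using ch p by (simp add: chain_toggle_pivot)
    ultimately show "toggle (pivot {e} X) X \<in> {X\<in>?S. ?U \<notin> X}"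
      using X ch ne by (auto simp: full_chains_def toggle_def)
  qed (rule pivot_toggle)
  \<comment> \<open>In a chain through \<open>U - {e}\<close> every member other than
    \<open>U\<close> lies inside \<open>U - {e}\<close>. Deleting \<open>U\<close> is therefore a
    bijection onto the full chains of \<open>U - {e}\<close> refining \<open>C - {U}\<close>, and it
    flips the sign.\<close>
  moreover have "(\<Sum>X\<in>{X\<in>?S. ?U \<in> X}. (-1) ^ card X) = ((-1) ^ Suc (card U) :: int)"
  proof -
    let ?S' = "{X. X \<in> full_chains ?U \<and> C - {U} \<subseteq> X}"
    have "(\<Sum>X\<in>{X\<in>?S. ?U \<in> X}. (-1) ^ card X) = (\<Sum>X\<in>?S'. - ((-1) ^ card X :: int))"
    proof (rule sum.reindex_bij_witness[where i = "insert U" and j = "\<lambda>X. X - {U}"])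
      fix X assume a: "X \<in> {X\<in>?S. ?U \<in> X}"
      then have X: "X \<subseteq> Pow U" "\<And>A B. A \<in> X \<Longrightarrow> B \<in> X \<Longrightarrow> A \<subseteq> B \<or> B \<subseteq> A" "{} \<in> X" "U \<in> X" "?U \<in> X"
        "C \<subseteq> X"
        by (auto simp: full_chains_def subset_chain_def)
      show "insert U (X - {U}) = X" using X by auto
      have "X - {U} \<subseteq> Pow ?U"
      proof
        fix A assume A: "A \<in> X - {U}"
        then have "A \<subseteq> ?U \<or> ?U \<subseteq> A" "A \<subseteq> U" "A \<noteq> U" using X by auto
        then show "A \<in> Pow ?U" by blast
      qed
      then show "X - {U} \<in> ?S'"
        using X e by (auto simp: full_chains_def subset_chain_def)
      have "finite X" using a Suc.prems finite_full_chain by blast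
      then have "card X = Suc (card (X - {U}))"
        using X by (metis card_Suc_Diff1)
      then show "- ((-1) ^ card (X - {U})) = ((-1) ^ card X :: int)" by simp
    next
      fix X assume "X \<in> ?S'"
      then have X: "X \<subseteq> Pow ?U" "\<And>A B. A \<in> X \<Longrightarrow> B \<in> X \<Longrightarrow> A \<subseteq> B \<or> B \<subseteq> A" "{} \<in> X" "?U \<in> X"
        "C - {U} \<subseteq> X"
        by (auto simp: full_chains_def subset_chain_def)
      show "insert U X - {U} = X" using X e by auto
      show "insert U X \<in> {X\<in>?S. ?U \<in> X}"
        using X by (auto simp: full_chains_def subset_chain_def)
    qed
    also have "\<dots> = - ((-1) ^ Suc (card ?U))"
    proof -
      have "subset.chain (Pow ?U) (C - {U})"
        using chD e by (auto simp: subset_chain_def)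
      then show ?thesis
        using Suc.hyps(1)[of ?U "C - {U}"] cU by (simp add: sum_negf)
    qed
    finally show ?thesis using cU(1) Suc.hyps(2) by simp
  qed
  moreover have "(\<Sum>X\<in>?S. (-1) ^ card X :: int)
      = (\<Sum>X\<in>{X\<in>?S. ?U \<in> X}. (-1) ^ card X) + (\<Sum>X\<in>{X\<in>?S. ?U \<notin> X}. (-1) ^ card X)"
  proof -
    have "finite ?S" using finite_full_chains[OF Suc.prems(1)] by simp
    moreover have "{X\<in>?S. ?U \<in> X} = ?S \<inter> {X. ?U \<in> X}" "{X\<in>?S. ?U \<notin> X} = ?S - {X. ?U \<in> X}"
      by blast+
    ultimately show ?thesis by (simp only: sum.Int_Diff)
  qed
  ultimately show ?case by simp
qed

text \<open>The identity behind inclusion-exclusion: for nonempty \<open>D\<close>, toggling one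
  fixed element cancels all terms.\<close>

lemma sum_Pow_alternating:
  assumes "finite D"
  shows "(\<Sum>C\<in>Pow D. (-1) ^ card C) = (of_bool (D = {}) :: int)"
proof (cases "D = {}")
  case False
  then obtain a where "a \<in> D" by blast
  then have "(\<Sum>C\<in>Pow D. (-1) ^ card C) = (0::int)"
    using assms by (intro sum_toggle_eq_0[where h = "\<lambda>_. a"]) (auto simp: toggle_def intro: finite_subset)
  with False show ?thesis by simp
qed simp

lemma sum_full_chains_avoiding:
  assumes U: "finite U" and B: "B \<subseteq> Pow U"
    and cone: "B \<noteq> {} \<Longrightarrow> \<exists>T\<in>B. \<forall>A\<in>B. A \<union> T \<in> B"
  shows "(\<Sum>X\<in>full_chains U. (-1) ^ card X * of_bool (X \<inter> B = {}))
    = ((-1) ^ Suc (card U) * of_bool (B = {}) :: int)"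
proof -
  let ?K = "{C. subset.chain B C}"
  have finB: "finite B" using U B by (simp add: finite_subset)
  have finK: "finite ?K"
    by (rule finite_subset[of _ "Pow B"]) (auto simp: finB subset_chain_def)
  have "(\<Sum>X\<in>full_chains U. (-1) ^ card X * of_bool (X \<inter> B = {}))
      = (\<Sum>X\<in>full_chains U. \<Sum>C | C \<in> ?K \<and> C \<subseteq> X. (-1) ^ card C * ((-1) ^ card X :: int))"
  proof (rule sum.cong[OF refl])
    fix X assume X: "X \<in> full_chains U"
    \<comment> \<open>Subsets of a chain are chains, so the chains of \<open>B\<close> contained in
      \<open>X\<close> are all the subsets of \<open>X \<inter> B\<close>.\<close>
    then have "A \<subseteq> A' \<or> A' \<subseteq> A" if "A \<in> X" "A' \<in> X" for A A'
      using that by (auto simp: full_chains_def subset_chain_def)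
    then have "subset.chain B C \<longleftrightarrow> C \<subseteq> B" if "C \<subseteq> X" for C
      using that unfolding subset_chain_def by (meson subsetD)
    then have "{C. C \<in> ?K \<and> C \<subseteq> X} = Pow (X \<inter> B)"
      by auto
    then have "(\<Sum>C | C \<in> ?K \<and> C \<subseteq> X. (-1) ^ card C * ((-1) ^ card X :: int))
      = (\<Sum>C\<in>Pow (X \<inter> B). (-1) ^ card C) * (-1) ^ card X"
      by (simp only: sum_distrib_right)
    also have "\<dots> = of_bool (X \<inter> B = {}) * (-1) ^ card X"
      by (simp only: sum_Pow_alternating[OF finite_Int[OF disjI2[OF finB]]])
    finally show "(-1) ^ card X * of_bool (X \<inter> B = {})
      = (\<Sum>C | C \<in> ?K \<and> C \<subseteq> X. (-1) ^ card C * ((-1) ^ card X :: int))"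
      by simp
  qed
  also have "\<dots> = (\<Sum>C\<in>?K. \<Sum>X | X \<in> full_chains U \<and> C \<subseteq> X. (-1) ^ card C * ((-1) ^ card X :: int))"
    by (rule sum.swap_restrict[OF finite_full_chains[OF U] finK])
  also have "\<dots> = (\<Sum>C\<in>?K. (-1) ^ card C * (-1) ^ Suc (card U))"
  proof (rule sum.cong[OF refl])
    fix C assume "C \<in> ?K"
    then have "subset.chain (Pow U) C"
      using B by (auto simp: subset_chain_def)
    then show "(\<Sum>X | X \<in> full_chains U \<and> C \<subseteq> X. (-1) ^ card C * ((-1) ^ card X :: int))
      = (-1) ^ card C * (-1) ^ Suc (card U)"
      by (simp only: sum_distrib_left[symmetric] sum_full_chains_refining[OF U])
  qed
  also have "\<dots> = (\<Sum>C\<in>?K. (-1) ^ card C) * (-1) ^ Suc (card U)"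
    by (simp only: sum_distrib_right)
  also have "(\<Sum>C\<in>?K. (-1) ^ card C) = (of_bool (B = {}) :: int)"
  proof (cases "B = {}")
    case True
    then have "?K = {{}}" by (auto simp: subset_chain_def)
    with True show ?thesis by simp
  next
    case False
    then obtain T where "T \<in> B" "\<And>A. A \<in> B \<Longrightarrow> A \<union> T \<in> B" using cone by blast
    then show ?thesis using sum_chains_conically_contractible[OF finB] False by simp
  qed
  finally show ?thesis by (simp only: mult.commute)
qed

section \<open>Chains as lists and as sets\<close>

text \<open>Different heads would each be strictly below the other; equal heads can be removed from
  both lists.\<close>

lemma sorted_psubset_unique:
  assumes "sorted_wrt (\<subset>) xs" "sorted_wrt (\<subset>) ys" "set xs = set ys"
  shows "xs = ys"
  using assms
proof (induction xs arbitrary: ys)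
  case Nil
  then show ?case by simp
next
  case (Cons x xs)
  then obtain y ys' where ys: "ys = y # ys'" by (cases ys) auto
  have xy: "x = y"
  proof (rule ccontr)
    assume "x \<noteq> y"
    then have "x \<in> set ys'" "y \<in> set xs" using Cons.prems(3) ys by auto
    then have "x \<subset> y" "y \<subset> x" using Cons.prems ys by auto
    then show False by blast
  qed
  moreover have "x \<notin> set xs" "y \<notin> set ys'" using Cons.prems ys by auto
  then have "set xs = set ys'" using Cons.prems(3) ys xy by auto
  ultimately show ?case using Cons ys by simp
qed

text \<open>Between comparable finite sets cardinality decides the direction of inclusion, so
  sorting by \<open>card\<close> suffices; distinctness makes the inclusions strict.\<close>

lemma ex_sorted_psubset:
  assumes "finite X" "subset.chain \<A> X" "\<And>A. A \<in> X \<Longrightarrow> finite A"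
  shows "\<exists>xs. sorted_wrt (\<subset>) xs \<and> set xs = X"
proof -
  obtain ys where ys: "set ys = X" "distinct ys"
    using assms(1) finite_distinct_list by blast
  define xs where "xs = sort_key card ys"
  have xs: "set xs = X" "distinct xs" "sorted (map card xs)"
    using ys by (simp_all add: xs_def)
  have "sorted_wrt (\<subset>) xs"
    unfolding sorted_wrt_iff_nth_less
  proof (intro allI impI)
    fix i j assume ij: "i < j" "j < length xs"
    then have X: "xs ! i \<in> X" "xs ! j \<in> X" and ne: "xs ! i \<noteq> xs ! j"
      using xs by (auto simp: nth_eq_iff_index_eq)
    have le: "card (xs ! i) \<le> card (xs ! j)"
      using ij xs(3) by (auto simp: sorted_iff_nth_mono_less)
    have "xs ! i \<subseteq> xs ! j \<or> xs ! j \<subseteq> xs ! i"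
      using X assms(2) by (auto simp: subset_chain_def)
    then show "xs ! i \<subset> xs ! j"
      using le ne X assms(3) by (metis card_seteq psubsetI)
  qed
  with xs show ?thesis by blast
qed

text \<open>Prepending \<open>{}\<close> supplies the member that the list omits. For
  \<open>d = 0\<close> the empty list corresponds to \<open>{{}}\<close>.\<close>

lemma bij_betw_is_chain_full_chains:
  "bij_betw (\<lambda>Xs. set ({} # Xs)) {Xs. is_chain d Xs} (full_chains {1..d})"
  unfolding bij_betw_def
proof
  show "inj_on (\<lambda>Xs. set ({} # Xs)) {Xs. is_chain d Xs}"
  proof (rule inj_onI)
    fix Xs Ys :: "nat set list"
    assume "Xs \<in> {Xs. is_chain d Xs}" "Ys \<in> {Xs. is_chain d Xs}" "set ({} # Xs) = set ({} # Ys)"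
    then have "{} # Xs = {} # Ys"
      by (intro sorted_psubset_unique) (simp_all only: is_chain_def mem_Collect_eq)
    then show "Xs = Ys" by simp
  qed
  show "(\<lambda>Xs. set ({} # Xs)) ` {Xs. is_chain d Xs} = full_chains {1..d}"
  proof (intro equalityI subsetI)
    fix X assume "X \<in> (\<lambda>Xs. set ({} # Xs)) ` {Xs. is_chain d Xs}"
    then obtain Xs where Xs: "is_chain d Xs" "X = set ({} # Xs)" by blast
    then have s: "sorted_wrt (\<subset>) ({} # Xs)" and l: "last ({} # Xs) = {1..d}"
      by (simp_all only: is_chain_def)
    have "\<forall>A\<in>set zs. \<forall>B\<in>set zs. A \<subseteq> B \<or> B \<subseteq> A" if "sorted_wrt (\<subset>) zs" for zs :: "nat set list"
      using that by (induction zs) auto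
    from this[OF s] have "\<forall>A\<in>X. \<forall>B\<in>X. A \<subseteq> B \<or> B \<subseteq> A"
      by (simp only: Xs(2))
    moreover have "X \<subseteq> Pow {1..d}"
      using is_chain_subset[OF Xs(1)] unfolding Xs(2) by force
    ultimately have "subset.chain (Pow {1..d}) X"
      by (simp only: subset_chain_def)
    moreover have "{1..d} \<in> X"
      using l Xs(2) last_in_set[of "{} # Xs"] by simp
    ultimately show "X \<in> full_chains {1..d}"
      using Xs(2) by (simp add: full_chains_def)
  next
    fix X assume X: "X \<in> full_chains {1..d}"
    then have ch: "subset.chain (Pow {1..d}) X" and mem: "{} \<in> X" "{1..d} \<in> X"
      by (auto simp: full_chains_def)
    have sub: "A \<subseteq> {1..d}" if "A \<in> X" for A
      using ch that by (auto simp: subset_chain_def)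
    then have "\<exists>xs. sorted_wrt (\<subset>) xs \<and> set xs = X"
      using finite_full_chain[OF _ X] ch by (intro ex_sorted_psubset) (auto intro: finite_subset)
    then obtain xs where xs: "sorted_wrt (\<subset>) xs" "set xs = X" by blast
    then obtain x Xs where xXs: "xs = x # Xs" using mem by (cases xs) auto
    have "x = {}" using xs xXs mem by auto
    have "last xs = {1..d}"
    proof (cases xs rule: rev_cases)
      case (snoc zs z)
      then have "{1..d} = z \<or> {1..d} \<subset> z" "z \<subseteq> {1..d}"
        using xs mem sub by (auto simp: sorted_wrt_append)
      then show ?thesis using snoc by auto
    qed (use xXs in simp)
    then have "is_chain d Xs"
      using xs xXs \<open>x = {}\<close> unfolding is_chain_def by simp
    then show "X \<in> (\<lambda>Xs. set ({} # Xs)) ` {Xs. is_chain d Xs}"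
      using xs xXs \<open>x = {}\<close> by (intro image_eqI[of _ _ Xs]) auto
  qed
qed

section \<open>Bad sets of a megamatroid\<close>

text \<open>Write f for rank minus coordinate sum, and let \<open>T\<close> minimise f over the bad
  sets. Submodularity gives f(A \<union> T) \<le> f(A) + f(T) - f(A \<inter> T) \<le> f(A) < 0 for
  every bad A.\<close>

lemma megamatroid_bad_sets_cone:
  fixes y :: "nat \<Rightarrow> real"
  assumes mm: "megamatroid d rk"
    and B: "B = {A. A \<subseteq> {1..d} \<and> rk A < ereal (\<Sum>i\<in>A. y i)}" "B \<noteq> {}"
  shows "\<exists>T\<in>B. \<forall>A\<in>B. A \<union> T \<in> B"
proof -
  define r where "r A = real_of_ereal (rk A)" for A
  define s where "s A = (\<Sum>i\<in>A. y i)" for A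
  have rk: "rk A = ereal (r A)" if "rk A \<in> int_ereals" for A
    using that by (auto simp: int_ereals_def r_def)
  \<comment> \<open>A value below a real number is not \<infinity>, so bad sets have integer rank
    and \<open>r\<close> may replace \<open>rk\<close> there.\<close>
  have int: "rk A \<in> int_ereals" "A \<subseteq> {1..d}" if "A \<in> B" for A
    using that mm unfolding B megamatroid_def by (auto simp: int_ereals_def)
  have iff: "A \<in> B \<longleftrightarrow> r A < s A" if "rk A \<in> int_ereals" "A \<subseteq> {1..d}" for A
    using that(2) by (simp add: B s_def rk[OF that(1)])
  have "finite B" unfolding B by simp
  then obtain T where T: "T \<in> B" "\<And>A. A \<in> B \<Longrightarrow> r T - s T \<le> r A - s A"
    using B(2) ex_min_if_finite[of "(\<lambda>A. r A - s A) ` B"] by (force simp: not_less)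
  have "A \<union> T \<in> B" if A: "A \<in> B" for A
  proof -
    have mem: "rk (A \<union> T) \<in> int_ereals" "rk (A \<inter> T) \<in> int_ereals"
      and le: "rk (A \<union> T) + rk (A \<inter> T) \<le> rk A + rk T"
      using mm int[OF A] int[OF T(1)] unfolding megamatroid_def by blast+
    have "r (A \<union> T) + r (A \<inter> T) \<le> r A + r T"
      using le by (simp add: rk[OF mem(1)] rk[OF mem(2)] rk[OF int(1)[OF A]] rk[OF int(1)[OF T(1)]])
    moreover have "s (A \<union> T) + s (A \<inter> T) = s A + s T"
      unfolding s_def using int[OF A] int[OF T(1)]
      by (intro sum.union_inter) (auto intro: finite_subset)
    moreover have sub: "A \<union> T \<subseteq> {1..d}" "A \<inter> T \<subseteq> {1..d}"
      using int[OF A] int[OF T(1)] by auto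
    \<comment> \<open>If \<open>A \<inter> T\<close> is bad this is minimality of \<open>T\<close>;
      otherwise the right side is nonnegative and the left side negative.\<close>
    moreover have "r T - s T \<le> r (A \<inter> T) - s (A \<inter> T)"
      using T iff[OF mem(2) sub(2)] iff[OF int[OF T(1)]] by (cases "A \<inter> T \<in> B") auto
    moreover have "r A < s A" using iff[OF int[OF A]] A by simp
    ultimately show ?thesis using iff[OF mem(1) sub(1)] by simp
  qed
  with T(1) show ?thesis by blast
qed

theorem theorem4p2:
  fixes d :: nat and rk :: "nat set \<Rightarrow> ereal"
  assumes "megamatroid d rk"
  shows "\<forall>y\<in>real_space d.
    (indicator (base_polyhedron d rk) y :: int) =
      (\<Sum>Xs\<in>{Xs. is_chain d Xs}.
         (-1) ^ (d - length Xs) * indicator (R_MM d Xs rk) y)"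
proof
  fix y assume y: "y \<in> real_space d"
  show "(indicator (base_polyhedron d rk) y :: int) =
    (\<Sum>Xs\<in>{Xs. is_chain d Xs}. (-1) ^ (d - length Xs) * indicator (R_MM d Xs rk) y)"
  proof (cases "ereal (\<Sum>i=1..d. y i) = rk {1..d}")
    case False
    then show ?thesis by (simp add: base_polyhedron_def R_MM_def indicator_def)
  next
    case True
    define B where "B = {A. A \<subseteq> {1..d} \<and> rk A < ereal (\<Sum>i\<in>A. y i)}"
    \<comment> \<open>The empty set is never bad, so prepending \<open>{}\<close> to a chain does
      not affect whether it avoids \<open>B\<close>.\<close>
    have "rk {} = 0" using assms by (simp add: megamatroid_def)
    then have empty: "{} \<notin> B" by (simp add: B_def zero_ereal_def)
    have "(\<Sum>Xs\<in>{Xs. is_chain d Xs}. (-1) ^ (d - length Xs) * indicator (R_MM d Xs rk) y)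
      = (\<Sum>Xs\<in>{Xs. is_chain d Xs}. (-1) ^ Suc d *
          ((-1) ^ card (set ({} # Xs)) * of_bool (set ({} # Xs) \<inter> B = {})) :: int)"
    proof (rule sum.cong[OF refl])
      fix Xs assume "Xs \<in> {Xs. is_chain d Xs}"
      then have Xs: "is_chain d Xs" by simp
      have "distinct zs" if "sorted_wrt (\<subset>) zs" for zs :: "nat set list"
        using that by (induction zs) auto
      then have "distinct ({} # Xs)" using Xs unfolding is_chain_def by blast
      then have "card (set ({} # Xs)) = Suc (length Xs)"
        by (metis distinct_card length_Cons)
      \<comment> \<open>Since \<open>length Xs \<le> d\<close>, the exponents
        \<open>d - length Xs\<close> and \<open>Suc d + Suc (length Xs)\<close> have the same
        parity.\<close>
      moreover have "(-1) ^ (d - length Xs) = ((-1) ^ Suc d * (-1) ^ Suc (length Xs) :: int)"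
        using is_chain_length[OF Xs] by (simp add: minus_one_power_iff)
      moreover have "(indicator (R_MM d Xs rk) y :: int) = of_bool (set ({} # Xs) \<inter> B = {})"
      proof -
        have "y \<in> R_MM d Xs rk \<longleftrightarrow> set Xs \<inter> B = {}"
        proof -
          have "X \<in> B \<longleftrightarrow> \<not> ereal (\<Sum>i\<in>X. y i) \<le> rk X" if "X \<in> set Xs" for X
            using is_chain_subset[OF Xs that] by (auto simp: B_def)
          then show ?thesis using y True by (auto simp: R_MM_def)
        qed
        then show ?thesis using empty by (simp add: indicator_def)
      qed
      ultimately show "(-1) ^ (d - length Xs) * indicator (R_MM d Xs rk) y
        = ((-1) ^ Suc d *
          ((-1) ^ card (set ({} # Xs)) * of_bool (set ({} # Xs) \<inter> B = {})) :: int)"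
        by (simp only: mult.assoc)
    qed
    also have "\<dots> = (-1) ^ Suc d * (\<Sum>X\<in>full_chains {1..d}. (-1) ^ card X * of_bool (X \<inter> B = {}))"
      unfolding sum_distrib_left[symmetric]
      using sum.reindex_bij_betw[OF bij_betw_is_chain_full_chains,
          of "\<lambda>X. (-1) ^ card X * of_bool (X \<inter> B = {})"] by simp
    also have "\<dots> = (-1) ^ Suc d * ((-1) ^ Suc (card {1..d}) * of_bool (B = {}))"
      using megamatroid_bad_sets_cone[OF assms B_def]
      by (subst sum_full_chains_avoiding) (auto simp: B_def)
    also have "\<dots> = of_bool (B = {})" by (simp add: minus_one_power_iff)
    also have "\<dots> = indicator (base_polyhedron d rk) y"
      using y True by (auto simp: base_polyhedron_def B_def indicator_def not_less)
    finally show ?thesis by simp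
  qed
qed

end
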